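(* (1) If $H$ is a layered graph, then $\chi_H(\mathbb{R}^2)>2$; if $H$ is an induced layered graph, then $\chi^{\mathrm{ind}}_H(\mathbb{R}^2)>2$. (2) There exists a bipartite graph $H$, namely the hypercube $H=Q_{11}$, such that $\chi_H(\mathbb{R}^2)=2$.
   Context: A unit-copy of a graph $H=(V,E)$ in $\mathbb{R}^2$ is a set $A$, $|A|=|V|$, with a bijection $f:V\to A$ such that $uv\in E$ implies $\|f(u)-f(v)\|=1$; it is induced if also $uv\notin E$ implies $\|f(u)-f(v)\|\ne1$. $\chi_H(\mathbb{R}^2)$ (resp. $\chi^{\mathrm{ind}}_H(\mathbb{R}^2)$) is the least $r$ such that some $r$-coloring of $\mathbb{R}^2$ contains no monochromatic unit-copy (resp. induced unit-copy) of $H$. The hypercube $Q_d$ has vertex set $\{0,1\}^d$ with adjacency meaning differing in exactly one coordinate; its $k$-th edge layer is the subgraph induced by the vertices with exactly $k$ or $k-1$ ones. A graph is (induced) layered if it is an (induced) subgraph of an edge layer of some hypercube. *)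

theory Defs
  imports
    "Graph_Theory.Pair_Digraph"
    "Graph_Theory.Digraph_Component"
    "Graph_Theory.Digraph_Isomorphism"
    "HOL-Analysis.Analysis"
begin

text \<open>
  A finite simple graph is a \<^typ>\<open>'a pair_pre_digraph\<close> satisfying the locale predicate
  \<^locale>\<open>pair_graph\<close>: the edge \<open>uv\<close> is present as the two arcs \<open>(u, v)\<close> and \<open>(v, u)\<close>.
\<close>

definition unit_copy :: "'a pair_pre_digraph \<Rightarrow> (real^2) set \<Rightarrow> bool" where
  "unit_copy H A \<longleftrightarrow>
     (\<exists>f. bij_betw f (pverts H) A \<and>
       (\<forall>u\<in>pverts H. \<forall>v\<in>pverts H. (u, v) \<in> parcs H \<longrightarrow> norm (f u - f v) = 1))"

definition induced_unit_copy :: "'a pair_pre_digraph \<Rightarrow> (real^2) set \<Rightarrow> bool" where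
  "induced_unit_copy H A \<longleftrightarrow>
     (\<exists>f. bij_betw f (pverts H) A \<and>
       (\<forall>u\<in>pverts H. \<forall>v\<in>pverts H.
          ((u, v) \<in> parcs H \<longrightarrow> norm (f u - f v) = 1) \<and>
          ((u, v) \<notin> parcs H \<longrightarrow> norm (f u - f v) \<noteq> 1)))"

definition plane_coloring :: "nat \<Rightarrow> (real^2 \<Rightarrow> nat) \<Rightarrow> bool" where
  "plane_coloring r c \<longleftrightarrow> (\<forall>x. c x < r)"

definition monochromatic :: "(real^2 \<Rightarrow> nat) \<Rightarrow> (real^2) set \<Rightarrow> bool" where
  "monochromatic c A \<longleftrightarrow> (\<exists>i. \<forall>x\<in>A. c x = i)"

text \<open>
  The chromatic numbers are extended naturals: they are \<open>\<infinity>\<close> (the infimum of the empty set)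
  when no finite number of colors suffices, for instance for edgeless graphs.
\<close>

definition chi_plane :: "'a pair_pre_digraph \<Rightarrow> enat" where
  "chi_plane H =
     Inf {enat r |r. \<exists>c. plane_coloring r c \<and> \<not> (\<exists>A. unit_copy H A \<and> monochromatic c A)}"

definition chi_ind_plane :: "'a pair_pre_digraph \<Rightarrow> enat" where
  "chi_ind_plane H =
     Inf {enat r |r. \<exists>c. plane_coloring r c \<and> \<not> (\<exists>A. induced_unit_copy H A \<and> monochromatic c A)}"

definition hypercube :: "nat \<Rightarrow> nat list pair_pre_digraph" where
  "hypercube d =
     (let V = {x. length x = d \<and> set x \<subseteq> {0, 1}}
      in \<lparr>pverts = V, parcs = {(x, y) \<in> V \<times> V. card {i. i < d \<and> x ! i \<noteq> y ! i} = 1}\<rparr>)"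

definition num_ones :: "nat list \<Rightarrow> nat" where
  "num_ones x = card {i. i < length x \<and> x ! i = 1}"

definition edge_layer :: "nat \<Rightarrow> nat \<Rightarrow> nat list pair_pre_digraph" where
  "edge_layer d k =
     (let L = {x \<in> pverts (hypercube d). num_ones x = k \<or> num_ones x + 1 = k}
      in \<lparr>pverts = L, parcs = {(x, y) \<in> parcs (hypercube d). x \<in> L \<and> y \<in> L}\<rparr>)"

definition layered :: "'a pair_pre_digraph \<Rightarrow> bool" where
  "layered H \<longleftrightarrow>
     (\<exists>d k L. 1 \<le> k \<and> k \<le> d \<and>
        subgraph (with_proj L) (with_proj (edge_layer d k)) \<and> digraph_iso (with_proj H) (with_proj L))"

definition induced_layered :: "'a pair_pre_digraph \<Rightarrow> bool" where
  "induced_layered H \<longleftrightarrow>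
     (\<exists>d k L. 1 \<le> k \<and> k \<le> d \<and>
        induced_subgraph (with_proj L) (with_proj (edge_layer d k)) \<and> digraph_iso (with_proj H) (with_proj L))"

definition bipartite :: "'a pair_pre_digraph \<Rightarrow> bool" where
  "bipartite H \<longleftrightarrow>
     (\<exists>X Y. X \<union> Y = pverts H \<and> X \<inter> Y = {} \<and> parcs H \<subseteq> X \<times> Y \<union> Y \<times> X)"

lemma pair_graph_hypercube: "pair_graph (hypercube d)"
proof -
  let ?V = "{x :: nat list. length x = d \<and> set x \<subseteq> {0, 1}}"
  have "finite ?V"
    using finite_lists_length_eq[of "{0, 1 :: nat}" d] by (simp add: conj_commute)
  moreover from this have "finite (parcs (hypercube d))"
    by (rule_tac finite_subset[of _ "?V \<times> ?V"]) (auto simp: hypercube_def Let_def)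
  moreover have "(y, x) \<in> parcs (hypercube d)" if "(x, y) \<in> parcs (hypercube d)" for x y
  proof -
    have "{i. i < d \<and> y ! i \<noteq> x ! i} = {i. i < d \<and> x ! i \<noteq> y ! i}" by auto
    with that show ?thesis by (simp add: hypercube_def Let_def)
  qed
  moreover have "fst e \<in> ?V \<and> snd e \<in> ?V \<and> fst e \<noteq> snd e"
    if "e \<in> parcs (hypercube d)" for e
  proof (intro conjI notI)
    show "fst e \<in> ?V" "snd e \<in> ?V"
      using that by (simp_all add: hypercube_def Let_def case_prod_beta mem_Times_iff)
    assume "fst e = snd e"
    then show False
      using that by (simp add: hypercube_def Let_def case_prod_beta)
  qed
  moreover have "pverts (hypercube d) = ?V"
    by (simp add: hypercube_def Let_def)
  ultimately show ?thesis
    by unfold_locales (simp_all add: symmetric_def sym_def)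
qed

lemma pair_graph_edge_layer: "pair_graph (edge_layer d k)"
proof -
  interpret Q: pair_graph "hypercube d" by (rule pair_graph_hypercube)
  have V: "pverts (edge_layer d k) \<subseteq> pverts (hypercube d)"
    by (auto simp: edge_layer_def Let_def)
  have E: "parcs (edge_layer d k) \<subseteq> parcs (hypercube d)"
    by (auto simp: edge_layer_def Let_def)
  have wf: "fst e \<in> pverts (edge_layer d k) \<and> snd e \<in> pverts (edge_layer d k)"
    if "e \<in> parcs (edge_layer d k)" for e
    using that by (auto simp: edge_layer_def Let_def)
  have sym: "(y, x) \<in> parcs (edge_layer d k)" if "(x, y) \<in> parcs (edge_layer d k)" for x y
    using that Q.arcs_symmetric by (simp add: edge_layer_def Let_def)
  have "fst e \<noteq> snd e" if "e \<in> parcs (edge_layer d k)" for e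
    using that E Q.pair_no_loops by blast
  then show ?thesis
    using finite_subset[OF V Q.pair_finite_verts] finite_subset[OF E Q.pair_finite_arcs] wf sym
    by unfold_locales (simp_all add: symmetric_def sym_def)
qed

end

theory Submission
  imports "HOL-Library.Ramsey" Defs
begin

text \<open>
  Layered graphs. Fix generic unit vectors \<open>b\<^sub>0, b\<^sub>1, \<dots>\<close> and let \<open>\<omega>\<close> be the rotation by 60 degrees, so that
  \<open>1 - \<omega>\<close> is a unit too. By Ramsey's theorem the color of \<open>\<Sum>\<^sub>j w\<^sub>j b\<^sub>i\<^sub>j\<close> with \<open>i\<^sub>1 < i\<^sub>2 < \<dots>\<close> may be
  assumed to depend only on the word \<open>w\<close> over \<open>{1, \<omega>}\<close>. If no copy of the layer \<open>k\<close> is monochromatic,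
  shortening a run of \<open>k\<close> equal letters changes the color. Then all words of a suitable shape
  have the same color, whatever their letters at \<open>d\<close> given positions are; exchanging \<open>\<omega>\<close> for \<open>1\<close> there
  is a translation by the unit vector \<open>(1 - \<omega>) b\<^sub>i\<close>, so even a full cube is monochromatic.

  The hypercube. Let \<open>F(x, y) = x + T(y)\<close> with \<open>T\<close> the triangle wave of slopes \<open>\<plusminus>1\<close> and period 6, and
  color by the parity of \<open>\<lfloor>F / \<surd>2\<rfloor>\<close>. A unit step changes \<open>F\<close> by at most \<open>\<surd>2\<close>, so \<open>F\<close> oscillates by
  less than \<open>\<surd>2\<close> on a monochromatic cube. Every 4-cycle of unit edges is a rhombus, so the cube is
  \<open>q + \<Sum>\<^sub>S v\<^sub>i\<close> for 11 unit vectors, which may be assumed to point upwards. Two of them point to the same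
  side, say right. Flat vectors change \<open>F\<close> wherever they are used, so the remaining nine climb more
  than \<open>9/\<surd>2 - 1 > 5\<close> and reach the bottom third of an interval where \<open>T\<close> increases; there the chosen two
  raise \<open>F\<close> by at least 2.
\<close>

section \<open>Generic unit vectors and Ramsey\<close>

definition plane_of_complex :: "complex \<Rightarrow> real^2" where
  "plane_of_complex z = vector [Re z, Im z]"

lemma norm_plane_of_complex_diff:
  "norm (plane_of_complex z - plane_of_complex w) = cmod (z - w)"
  by (simp add: plane_of_complex_def norm_vec_def L2_set_def UNIV_2 cmod_def)

text \<open>A difference of two cube vertices has the form \<open>sum a S - sum a T\<close> with
  \<open>S\<close> and \<open>T\<close> disjoint. The first clause keeps vertices distinct; the
  second confines unit distance to edges, which induced copies need. Singletons show that each
  \<open>a i\<close> is a unit vector.\<close>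

definition generic :: "(nat \<Rightarrow> complex) \<Rightarrow> bool" where
  "generic a \<longleftrightarrow> (\<forall>S T. finite S \<longrightarrow> finite T \<longrightarrow> S \<inter> T = {} \<longrightarrow>
     (sum a S - sum a T = 0 \<longleftrightarrow> S \<union> T = {}) \<and>
     (cmod (sum a S - sum a T) = 1 \<longleftrightarrow> card (S \<union> T) = 1))"

lemma generic_comp:
  assumes "generic a" "inj h"
  shows "generic (a \<circ> h)"
  unfolding generic_def
proof (intro allI impI)
  fix S T :: "nat set"
  assume fin: "finite S" "finite T" and disj: "S \<inter> T = {}"
  have sums: "sum (a \<circ> h) S = sum a (h ` S)" "sum (a \<circ> h) T = sum a (h ` T)"
    using assms(2) by (simp_all add: sum.reindex inj_on_subset)
  have "h ` S \<inter> h ` T = {}"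
    using disj assms(2) by (auto dest: injD)
  moreover have "card (h ` S \<union> h ` T) = card (S \<union> T)"
    using assms(2) by (metis card_image image_Un inj_on_subset subset_UNIV)
  ultimately show "(sum (a \<circ> h) S - sum (a \<circ> h) T = 0 \<longleftrightarrow> S \<union> T = {}) \<and>
     (cmod (sum (a \<circ> h) S - sum (a \<circ> h) T) = 1 \<longleftrightarrow> card (S \<union> T) = 1)"
    unfolding sums using assms(1) fin unfolding generic_def
    by (metis finite_imageI image_Un image_is_empty)
qed

text \<open>Two distinct unit circles meet in finitely many points: squaring
  \<open>cmod (p + v) = 1\<close>, multiplying by \<open>v\<close> and using
  \<open>v * cnj v = 1\<close> gives a quadratic equation for \<open>v\<close> with leading
  coefficient \<open>cnj p\<close>.\<close>

lemma finite_unit_circle_inter_translate: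
  assumes "p \<noteq> 0"
  shows "finite {v. cmod v = 1 \<and> cmod (p + v) = 1}"
proof -
  have "poly [:p, of_real ((cmod p)\<^sup>2), cnj p:] v = 0" if "cmod v = 1" "cmod (p + v) = 1" for v
  proof -
    have v: "v * cnj v = 1" and pv: "(p + v) * (cnj p + cnj v) = 1"
      using that by (metis complex_norm_square of_real_1 one_power2 complex_cnj_add)+
    have "0 = v * ((p + v) * (cnj p + cnj v) - 1)" by (simp add: pv)
    also have "\<dots> = p * (v * cnj v) + v * (p * cnj p) + cnj p * v * v + v * (v * cnj v) - v"
      by (simp add: algebra_simps)
    also have "\<dots> = p + v * of_real ((cmod p)\<^sup>2) + cnj p * v * v"
      by (simp add: v complex_norm_square del: of_real_power)
    finally show ?thesis by (simp add: algebra_simps)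
  qed
  then show ?thesis
    using assms by (intro finite_subset[OF _ poly_roots_finite[of "[:p, of_real ((cmod p)\<^sup>2), cnj p:]"]]) auto
qed

text \<open>The vectors are chosen one after another on the unit circle. Each nonzero signed sum of
  earlier ones forbids only finitely many choices, and in any signed sum the term of largest index
  settles both clauses of \<open>generic\<close>.\<close>

lemma exists_generic: "\<exists>a. generic a"
proof -
  let ?P = "\<lambda>(a :: nat \<Rightarrow> complex) n v. cmod v = 1 \<and> (\<forall>S\<subseteq>{..<n}. \<forall>T\<subseteq>{..<n}.
    sum a S - sum a T \<noteq> 0 \<longrightarrow> sum a S - sum a T + v \<noteq> 0 \<and> cmod (sum a S - sum a T + v) \<noteq> 1)"
  have "\<exists>a. \<forall>n. ?P a n (a n)"
  proof (rule dependent_wellorder_choice)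
    fix v n and a b :: "nat \<Rightarrow> complex"
    assume "\<And>m. m < n \<Longrightarrow> a m = b m"
    then have "sum a S = sum b S" if "S \<subseteq> {..<n}" for S
      using that by (intro sum.cong) auto
    then show "?P a n v = ?P b n v" by simp
  next
    fix n and a :: "nat \<Rightarrow> complex"
    let ?D = "(\<lambda>(S, T). sum a S - sum a T) ` (Pow {..<n} \<times> Pow {..<n}) - {0}"
    let ?B = "\<Union>p\<in>?D. insert (- p) {v. cmod v = 1 \<and> cmod (p + v) = 1}"
    have "finite ?B"
      by (auto intro!: finite_unit_circle_inter_translate)
    moreover have "infinite {v. cmod v = 1}"
    proof
      assume "finite {v. cmod v = 1}"
      moreover have "{0..1} \<subseteq> Re ` {v. cmod v = 1}"
      proof
        fix t :: real assume "t \<in> {0..1}"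
        then have "cmod (Complex t (sqrt (1 - t\<^sup>2))) = 1"
          by (simp add: cmod_def power_le_one)
        then show "t \<in> Re ` {v. cmod v = 1}"
          by (intro image_eqI[of _ _ "Complex t (sqrt (1 - t\<^sup>2))"]) auto
      qed
      ultimately show False
        using infinite_Icc[of 0 "1 :: real"] by (simp add: finite_subset[OF _ finite_imageI])
    qed
    ultimately have "\<not> {v. cmod v = 1} \<subseteq> ?B"
      using finite_subset by blast
    then obtain v where v: "cmod v = 1" "v \<notin> ?B"
      by blast
    have "?P a n v"
    proof (intro conjI allI impI v(1))
      fix S T assume "S \<subseteq> {..<n}" "T \<subseteq> {..<n}" and ne: "sum a S - sum a T \<noteq> 0"
      then have "sum a S - sum a T \<in> ?D" by force
      then have "v \<noteq> - (sum a S - sum a T)" "\<not> (cmod v = 1 \<and> cmod (sum a S - sum a T + v) = 1)"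
        using v(2) by blast+
      then show "sum a S - sum a T + v \<noteq> 0" "cmod (sum a S - sum a T + v) \<noteq> 1"
        using v(1) by (simp_all only: add_eq_0_iff simp_thms)
    qed
    then show "\<exists>v. ?P a n v" by blast
  qed
  then obtain a where a: "\<And>n. ?P a n (a n)" by blast
  have nonzero: "sum a S - sum a T \<noteq> 0 \<and> (card (S \<union> T) \<noteq> 1 \<longrightarrow> cmod (sum a S - sum a T) \<noteq> 1)"
    if "finite S" "finite T" "S \<inter> T = {}" "S \<union> T \<noteq> {}" for S T
    using that
  proof (induction "card (S \<union> T)" arbitrary: S T rule: less_induct)
    case less
    have top: "sum a S - sum a T \<noteq> 0 \<and> (card (S \<union> T) \<noteq> 1 \<longrightarrow> cmod (sum a S - sum a T) \<noteq> 1)"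
      if ST: "finite S" "finite T" "S \<inter> T = {}" "n \<in> S" "\<forall>m\<in>S \<union> T. m \<le> n"
        and IH: "(S - {n}) \<union> T \<noteq> {} \<Longrightarrow> sum a (S - {n}) - sum a T \<noteq> 0" for S T n
    proof -
      have split: "sum a S - sum a T = sum a (S - {n}) - sum a T + a n"
        using ST by (simp add: sum.remove)
      show ?thesis
      proof (cases "(S - {n}) \<union> T = {}")
        case True
        then have "S = {n}" "T = {}" using ST by auto
        then show ?thesis using a[of n] by auto
      next
        case False
        have "S - {n} \<subseteq> {..<n}" "T \<subseteq> {..<n}"
          using ST by (auto simp: le_less)
        then show ?thesis
          unfolding split using a[of n] IH[OF False] by blast
      qed
    qed
    define n where "n = Max (S \<union> T)"
    have "n \<in> S \<union> T"
      unfolding n_def using less.prems by (intro Max_in) auto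
    moreover have "\<forall>m\<in>S \<union> T. m \<le> n"
      unfolding n_def using less.prems by (intro ballI Max_ge) auto
    ultimately have n: "n \<in> S \<union> T" "\<forall>m\<in>S \<union> T. m \<le> n" .
    show ?case
    proof (cases "n \<in> S")
      case True
      have "card ((S - {n}) \<union> T) < card (S \<union> T)"
        using less.prems True by (intro psubset_card_mono) auto
      then have "sum a (S - {n}) - sum a T \<noteq> 0" if "(S - {n}) \<union> T \<noteq> {}"
        using less.hyps[of "S - {n}" T] less.prems that by blast
      then show ?thesis using top[of S T n] True n less.prems by blast
    next
      case False
      then have nT: "n \<in> T" using n by blast
      have "card ((T - {n}) \<union> S) < card (S \<union> T)"
        using less.prems nT by (intro psubset_card_mono) auto
      then have "sum a (T - {n}) - sum a S \<noteq> 0" if "(T - {n}) \<union> S \<noteq> {}"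
        using less.hyps[of "T - {n}" S] less.prems that by blast
      then have "sum a T - sum a S \<noteq> 0 \<and> (card (T \<union> S) \<noteq> 1 \<longrightarrow> cmod (sum a T - sum a S) \<noteq> 1)"
        using top[of T S n] nT n less.prems by blast
      then show ?thesis by (metis Un_commute minus_diff_eq neg_0_equal_iff_equal norm_minus_commute)
    qed
  qed
  have unit: "cmod (sum a S - sum a T) = 1" if "finite S" "finite T" "S \<inter> T = {}" "card (S \<union> T) = 1" for S T
  proof -
    obtain n where "S \<union> T = {n}" using \<open>card (S \<union> T) = 1\<close> card_1_singletonE by blast
    then have "S = {n} \<and> T = {} \<or> S = {} \<and> T = {n}"
      using that(3) by (auto simp: Un_singleton_iff)
    then show ?thesis using a[of n] by auto
  qed
  have "generic a"
    unfolding generic_def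
  proof (intro allI impI conjI iffI)
    fix S T :: "nat set"
    assume *: "finite S" "finite T" "S \<inter> T = {}"
    show "S \<union> T = {}" if "sum a S - sum a T = 0" using nonzero[of S T] * that by blast
    show "sum a S - sum a T = 0" if "S \<union> T = {}" using that by simp
    show "card (S \<union> T) = 1" if "cmod (sum a S - sum a T) = 1"
      using nonzero[of S T] * that by (cases "S \<union> T = {}") auto
    show "cmod (sum a S - sum a T) = 1" if "card (S \<union> T) = 1" using unit * that by blast
  qed
  then show ?thesis by blast
qed

text \<open>For a fixed word, \<open>C w\<close> colors the sets of \<open>length w\<close> indices,
  each listed in increasing order. Ramsey's theorem is applied to one word of \<open>W\<close> after
  another; earlier homogeneity survives passing to an infinite subset, and \<open>h\<close>
  enumerates the last one.\<close>

lemma infinite_ramsey_words: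
  fixes C :: "'a list \<Rightarrow> nat list \<Rightarrow> nat"
  assumes bound: "\<And>w xs. C w xs < s" and "finite W"
  obtains h :: "nat \<Rightarrow> nat" and t where "strict_mono h"
    "\<And>w xs. w \<in> W \<Longrightarrow> sorted_wrt (<) xs \<Longrightarrow> length xs = length w \<Longrightarrow> C w (map h xs) = t w"
proof -
  have "\<exists>M. infinite M \<and> (\<forall>w\<in>W. \<exists>t. \<forall>X\<subseteq>M. finite X \<longrightarrow> card X = length w \<longrightarrow>
          C w (sorted_list_of_set X) = t)"
    using \<open>finite W\<close>
  proof induction
    case empty
    show ?case using infinite_UNIV_nat by blast
  next
    case (insert w W)
    then obtain M where M: "infinite M"
      "\<forall>w\<in>W. \<exists>t. \<forall>X\<subseteq>M. finite X \<longrightarrow> card X = length w \<longrightarrow> C w (sorted_list_of_set X) = t"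
      by blast
    obtain Y t where Y: "Y \<subseteq> M" "infinite Y"
      "\<forall>X. X \<subseteq> Y \<and> finite X \<and> card X = length w \<longrightarrow> C w (sorted_list_of_set X) = t"
      using Ramsey[of M "length w" "\<lambda>X. C w (sorted_list_of_set X)" s] M(1) bound by blast
    have "\<forall>v\<in>insert w W. \<exists>t. \<forall>X\<subseteq>Y. finite X \<longrightarrow> card X = length v \<longrightarrow> C v (sorted_list_of_set X) = t"
    proof
      fix v assume "v \<in> insert w W"
      then consider "v = w" | "v \<in> W" by blast
      then show "\<exists>t. \<forall>X\<subseteq>Y. finite X \<longrightarrow> card X = length v \<longrightarrow> C v (sorted_list_of_set X) = t"
      proof cases
        case 1
        show ?thesis unfolding 1 using Y(3) by auto
      next
        case 2
        from bspec[OF M(2) 2] obtain t where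
          "\<forall>X\<subseteq>M. finite X \<longrightarrow> card X = length v \<longrightarrow> C v (sorted_list_of_set X) = t" ..
        then show ?thesis using Y(1) by (intro exI[of _ t]) auto
      qed
    qed
    then show ?case using Y(2) by blast
  qed
  then obtain M where M: "infinite M" "\<forall>w\<in>W. \<exists>t. \<forall>X\<subseteq>M. finite X \<longrightarrow> card X = length w \<longrightarrow>
          C w (sorted_list_of_set X) = t" by blast
  from bchoice[OF M(2)] obtain t where t: "\<And>w X. w \<in> W \<Longrightarrow> X \<subseteq> M \<Longrightarrow> finite X \<Longrightarrow> card X = length w \<Longrightarrow>
          C w (sorted_list_of_set X) = t w" by blast
  have mono: "strict_mono (enumerate M)" using M(1) by (rule strict_mono_enumerate)
  moreover have "C w (map (enumerate M) xs) = t w"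
    if "w \<in> W" "sorted_wrt (<) xs" "length xs = length w" for w xs
  proof -
    let ?ys = "map (enumerate M) xs"
    have srt: "sorted_wrt (<) ?ys"
      using that(2) mono by (auto simp: sorted_wrt_map strict_mono_def intro: sorted_wrt_mono_rel)
    then have ys: "sorted_list_of_set (set ?ys) = ?ys" "distinct ?ys"
      using sorted_list_of_set.idem_if_sorted_distinct strict_sorted_iff by blast+
    have "set ?ys \<subseteq> M" using M(1) by (auto simp: enumerate_in_set)
    moreover have "card (set ?ys) = length w" using ys(2) that(3) by (metis distinct_card length_map)
    ultimately show ?thesis using t[OF that(1), of "set ?ys"] ys(1) by simp
  qed
  ultimately show ?thesis by (rule that)
qed

section \<open>Embedded hypercubes and colored words\<close>

definition support :: "nat list \<Rightarrow> nat set" where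
  "support x = {i. i < length x \<and> x ! i = 1}"

lemma finite_support [simp]: "finite (support x)"
  by (simp add: support_def)

lemma support_subset: "x \<in> pverts (hypercube d) \<Longrightarrow> support x \<subseteq> {..<d}"
  by (auto simp: hypercube_def support_def)

lemma num_ones_eq_card_support: "num_ones x = card (support x)"
  by (simp add: num_ones_def support_def)

lemma hypercube_nth:
  assumes "x \<in> pverts (hypercube d)" "i < d"
  shows "x ! i = (if i \<in> support x then 1 else 0)"
proof -
  have "x ! i \<in> {0, 1}"
    using assms subsetD[OF _ nth_mem, of x "{0, 1}" i] by (simp add: hypercube_def)
  then show ?thesis
    using assms by (auto simp: hypercube_def support_def)
qed

lemma hypercube_length: "x \<in> pverts (hypercube d) \<Longrightarrow> length x = d"
  by (simp add: hypercube_def)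

lemma inj_on_support: "inj_on support (pverts (hypercube d))"
  by (intro inj_onI nth_equalityI) (simp_all add: hypercube_length hypercube_nth)

lemma hypercube_arc_iff:
  assumes "x \<in> pverts (hypercube d)" "y \<in> pverts (hypercube d)"
  shows "(x, y) \<in> parcs (hypercube d) \<longleftrightarrow>
    card ((support x - support y) \<union> (support y - support x)) = 1"
proof -
  have "{i. i < d \<and> x ! i \<noteq> y ! i} = (support x - support y) \<union> (support y - support x)"
    using support_subset[OF assms(1)] support_subset[OF assms(2)]
    by (auto simp: hypercube_nth[OF assms(1)] hypercube_nth[OF assms(2)] split: if_splits)
  moreover have "(x, y) \<in> parcs (hypercube d) \<longleftrightarrow> card {i. i < d \<and> x ! i \<noteq> y ! i} = 1"
    using assms by (simp add: hypercube_def Let_def)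
  ultimately show ?thesis by simp
qed

definition vertex_of_set :: "nat \<Rightarrow> nat set \<Rightarrow> nat list" where
  "vertex_of_set d S = map (\<lambda>i. if i \<in> S then 1 else 0) [0..<d]"

lemma vertex_of_set_in_hypercube: "vertex_of_set d S \<in> pverts (hypercube d)"
  by (auto simp: vertex_of_set_def hypercube_def)

lemma support_vertex_of_set: "support (vertex_of_set d S) = S \<inter> {..<d}"
  by (auto simp: vertex_of_set_def support_def split: if_splits)

lemma bipartite_hypercube: "bipartite (hypercube d)"
proof -
  let ?X = "{x \<in> pverts (hypercube d). even (card (support x))}"
  let ?Y = "{x \<in> pverts (hypercube d). odd (card (support x))}"
  have "(x, y) \<in> ?X \<times> ?Y \<union> ?Y \<times> ?X" if xy: "(x, y) \<in> parcs (hypercube d)" for x y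
  proof -
    have V: "x \<in> pverts (hypercube d)" "y \<in> pverts (hypercube d)"
      using xy by (auto simp: hypercube_def Let_def)
    then have "card ((support x - support y) \<union> (support y - support x)) = 1"
      using xy hypercube_arc_iff by blast
    moreover have "card ((support x - support y) \<union> (support y - support x)) =
        card (support x - support y) + card (support y - support x)"
      by (intro card_Un_disjoint) auto
    moreover have "card (support x) = card (support x - support y) + card (support x \<inter> support y)"
      "card (support y) = card (support y - support x) + card (support x \<inter> support y)"
      by (metis Int_Diff_disjoint Un_Diff_Int card_Un_disjoint finite_Diff finite_Int finite_support
          inf_commute)+
    ultimately have "even (card (support x)) \<longleftrightarrow> odd (card (support y))"
      by presburger
    then show ?thesis using V by auto
  qed
  then have "parcs (hypercube d) \<subseteq> ?X \<times> ?Y \<union> ?Y \<times> ?X" by auto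
  then show ?thesis unfolding bipartite_def by (intro exI[of _ ?X] exI[of _ ?Y]) auto
qed

text \<open>The unit factor \<open>z\<close> turns the cube: the layers considered below lie along
  \<open>b\<close>, \<open>\<omega> * b\<close> or \<open>(1 - \<omega>) * b\<close>.\<close>

definition cube_embedding :: "(nat \<Rightarrow> complex) \<Rightarrow> complex \<Rightarrow> complex \<Rightarrow> nat list \<Rightarrow> real^2" where
  "cube_embedding b p z x = plane_of_complex (p + z * sum b (support x))"

lemma cube_embedding_dist:
  assumes "cmod z = 1"
  shows "norm (cube_embedding b p z x - cube_embedding b p z y) =
    cmod (sum b (support x - support y) - sum b (support y - support x))"
proof -
  have "sum b (support x) - sum b (support y) =
      sum b (support x - support y) - sum b (support y - support x)"
    using sum.Int_Diff[of "support x" b "support y"] sum.Int_Diff[of "support y" b "support x"]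
    by (simp add: Int_commute)
  then have "cmod (p + z * sum b (support x) - (p + z * sum b (support y))) =
      cmod z * cmod (sum b (support x - support y) - sum b (support y - support x))"
    by (metis add_diff_cancel_left norm_mult right_diff_distrib)
  then show ?thesis
    by (simp add: cube_embedding_def norm_plane_of_complex_diff assms)
qed

lemma inj_on_cube_embedding:
  assumes "generic b" "cmod z = 1"
  shows "inj_on (cube_embedding b p z) (pverts (hypercube d))"
proof (rule inj_onI)
  fix x y assume V: "x \<in> pverts (hypercube d)" "y \<in> pverts (hypercube d)"
    and "cube_embedding b p z x = cube_embedding b p z y"
  then have "sum b (support x - support y) - sum b (support y - support x) = 0"
    using cube_embedding_dist[OF assms(2), of b p x y] by simp
  then have "(support x - support y) \<union> (support y - support x) = {}"
    using assms(1) unfolding generic_def by (metis Diff_disjoint Int_Diff finite_Diff finite_support inf_commute)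
  then have "support x = support y" by blast
  then show "x = y" using V inj_on_support by (metis inj_onD)
qed

lemma cube_embedding_unit_iff:
  assumes "generic b" "cmod z = 1" "x \<in> pverts (hypercube d)" "y \<in> pverts (hypercube d)"
  shows "norm (cube_embedding b p z x - cube_embedding b p z y) = 1 \<longleftrightarrow> (x, y) \<in> parcs (hypercube d)"
proof -
  have "(support x - support y) \<inter> (support y - support x) = {}" by blast
  then show ?thesis
    unfolding cube_embedding_dist[OF assms(2)] hypercube_arc_iff[OF assms(3,4)]
    using assms(1) unfolding generic_def by simp
qed

section \<open>Points coded by words over two letters\<close>

definition word_sum :: "(nat \<Rightarrow> complex) \<Rightarrow> complex list \<Rightarrow> nat list \<Rightarrow> complex" where
  "word_sum b w xs = (\<Sum>(z, i)\<leftarrow>zip w xs. z * b i)"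

lemma word_sum_simps [simp]:
  "word_sum b [] xs = 0" "word_sum b w [] = 0"
  "word_sum b (z # w) (i # xs) = z * b i + word_sum b w xs"
  by (simp_all add: word_sum_def)

lemma word_sum_append:
  "length w = length xs \<Longrightarrow> word_sum b (w @ w') (xs @ xs') = word_sum b w xs + word_sum b w' xs'"
  by (simp add: word_sum_def)

lemma word_sum_map: "word_sum b w (map h xs) = word_sum (b \<circ> h) w xs"
  by (induction w xs rule: list_induct2') simp_all

lemma word_sum_replicate:
  "word_sum b (replicate (length xs) z) xs = z * (\<Sum>i\<leftarrow>xs. b i)"
  by (induction xs) (simp_all add: algebra_simps)

text \<open>The closing \<open>replicate k 1\<close> gives the last letter, too, a run of ones to
  join.\<close>

fun padded_word :: "nat \<Rightarrow> complex \<Rightarrow> complex list \<Rightarrow> complex list" where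
  "padded_word k \<omega> [] = replicate k 1"
| "padded_word k \<omega> (y # ys) = replicate k 1 @ replicate k \<omega> @ y # padded_word k \<omega> ys"

lemma length_padded_word [simp]:
  "length (padded_word k \<omega> ys) = length ys * (2 * k + 1) + k"
  by (induction ys) simp_all

lemma set_padded_word: "set (padded_word k \<omega> ys) \<subseteq> {1, \<omega>} \<union> set ys"
  by (induction ys) auto

lemma padded_word_prefix: "\<exists>v. padded_word k \<omega> ys = replicate k 1 @ v"
  by (cases ys) auto

text \<open>The padding makes each letter \<open>y \<in> {1, \<omega>}\<close> complete a run of exactly \<open>Suc k\<close>
  equal letters, with the run before it or with the one after it.\<close>

lemma padded_word_color_eq:
  fixes t :: "complex list \<Rightarrow> nat"
  assumes flip: "\<And>u z v. z \<in> {1, \<omega>} \<Longrightarrow> set u \<subseteq> {1, \<omega>} \<Longrightarrow> set v \<subseteq> {1, \<omega>} \<Longrightarrow>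
      length u + Suc k + length v \<le> K \<Longrightarrow>
      t (u @ replicate (Suc k) z @ v) + t (u @ replicate k z @ v) = 1"
    and "length ys = length ys'" "set ys \<subseteq> {1, \<omega>}" "set ys' \<subseteq> {1, \<omega>}" "set u \<subseteq> {1, \<omega>}"
    and "length u + length (padded_word k \<omega> ys) \<le> K"
  shows "t (u @ padded_word k \<omega> ys) = t (u @ padded_word k \<omega> ys')"
  using assms(2-)
proof (induction ys ys' arbitrary: u rule: list_induct2)
  case Nil
  then show ?case by simp
next
  case (Cons y ys y' ys')
  let ?u = "u @ replicate k 1 @ replicate k \<omega>"
  \<comment> \<open>Removing the letter \<open>y\<close> shortens a run of \<open>Suc k\<close>
    equal letters to \<open>k\<close>; the sum 1 says that the color switches between 0 and 1. What
    remains does not depend on \<open>y\<close>, so \<open>y\<close> and \<open>y'\<close> can be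
    compared through it.\<close>
  have *: "t (u @ padded_word k \<omega> (y # ys)) + t (?u @ padded_word k \<omega> ys) = 1"
    if y: "y \<in> {1, \<omega>}" and ys: "set ys \<subseteq> {1, \<omega>}"
      and K: "length u + length (padded_word k \<omega> (y # ys)) \<le> K" for y ys
  proof (cases "y = \<omega>")
    case True
    have eq: "u @ padded_word k \<omega> (y # ys) =
        (u @ replicate k 1) @ replicate (Suc k) \<omega> @ padded_word k \<omega> ys"
      by (simp add: True replicate_app_Cons_same)
    have "t ((u @ replicate k 1) @ replicate (Suc k) \<omega> @ padded_word k \<omega> ys) +
        t ((u @ replicate k 1) @ replicate k \<omega> @ padded_word k \<omega> ys) = 1"
      using Cons.prems(3) ys K set_padded_word[of k \<omega> ys] by (intro flip) auto
    then show ?thesis unfolding eq by (simp only: append_assoc)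
  next
    case False
    obtain v where v: "padded_word k \<omega> ys = replicate k 1 @ v"
      using padded_word_prefix by blast
    have "set v \<subseteq> {1, \<omega>}" "length v + k = length (padded_word k \<omega> ys)"
      using set_padded_word[of k \<omega> ys] ys v by auto
    moreover have "u @ padded_word k \<omega> (y # ys) = ?u @ replicate (Suc k) 1 @ v"
      using y False by (simp add: v)
    moreover from calculation have "t (?u @ replicate (Suc k) 1 @ v) + t (?u @ replicate k 1 @ v) = 1"
      using Cons.prems(3) K by (intro flip) auto
    ultimately show ?thesis by (simp only: v)
  qed
  have "t (?u @ padded_word k \<omega> ys) = t (?u @ padded_word k \<omega> ys')"
    using Cons.prems by (intro Cons.IH) auto
  moreover have "t (u @ padded_word k \<omega> (y # ys)) + t (?u @ padded_word k \<omega> ys) = 1"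
    using Cons.prems by (intro *) auto
  moreover have "t (u @ padded_word k \<omega> (y' # ys')) + t (?u @ padded_word k \<omega> ys') = 1"
    using Cons.prems Cons.hyps by (intro *) auto
  ultimately show ?case by linarith
qed

text \<open>A block has \<open>k\<close> ones, \<open>k\<close> letters \<open>\<omega>\<close> and
  one letter of \<open>ys\<close>, so letter \<open>i\<close> meets the index
  \<open>m + 2 * k + i * (2 * k + 1)\<close>. The padding contributes equally to both words; only
  letters other than \<open>\<omega>\<close> make a difference.\<close>

lemma word_sum_padded_word:
  "word_sum b (padded_word k \<omega> ys) [m..<m + length (padded_word k \<omega> ys)] =
   word_sum b (padded_word k \<omega> (replicate (length ys) \<omega>)) [m..<m + length (padded_word k \<omega> ys)] +
   (\<Sum>i<length ys. (ys ! i - \<omega>) * b (m + 2 * k + i * (2 * k + 1)))"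
proof (induction ys arbitrary: m)
  case Nil
  then show ?case by simp
next
  case (Cons y ys)
  let ?l = "length (padded_word k \<omega> ys)" and ?n = "m + 2 * k"
  have upt: "[m..<m + length (padded_word k \<omega> (y # ys))] =
      [m..<m + k] @ [m + k..<m + k + k] @ ?n # [Suc ?n..<Suc ?n + ?l]"
  proof -
    have "[m..<m + length (padded_word k \<omega> (y # ys))] = [m..<m + (k + (k + (Suc ?l)))]"
      by (simp add: algebra_simps)
    also have "\<dots> = [m..<m + k] @ [m + k..<m + k + k] @ [m + k + k..<m + k + k + Suc ?l]"
      by (metis add.assoc le_add1 upt_add_eq_append)
    also have "[m + k + k..<m + k + k + Suc ?l] = ?n # [Suc ?n..<Suc ?n + ?l]"
      using upt_conv_Cons[of ?n "?n + Suc ?l"] by (simp add: mult_2 add.assoc del: length_padded_word)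
    finally show ?thesis .
  qed
  have "(\<Sum>i<length (y # ys). ((y # ys) ! i - \<omega>) * b (m + 2 * k + i * (2 * k + 1))) =
      (y - \<omega>) * b ?n + (\<Sum>i<length ys. (ys ! i - \<omega>) * b (Suc ?n + 2 * k + i * (2 * k + 1)))"
    by (simp add: sum.lessThan_Suc_shift algebra_simps del: sum.lessThan_Suc)
  then show ?case
    unfolding upt using Cons.IH[of "Suc ?n"]
    by (simp add: word_sum_append algebra_simps)
qed

text \<open>\<open>Suc k\<close> and \<open>k\<close> are the two levels of edge layer
  \<open>Suc k\<close>. Without monochromatic layers along \<open>b\<close> and
  \<open>\<omega> * b\<close>, all padded words with \<open>d\<close> letters have one color, and
  these words contain a cube along \<open>(1 - \<omega>) * b\<close>, hence a layer after
  all.\<close>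

lemma exists_monochromatic_layer:
  fixes c :: "complex \<Rightarrow> nat"
  assumes c: "\<And>x. c x < 2"
  shows "\<exists>b p z i. generic b \<and> cmod z = 1 \<and>
    (\<forall>S\<subseteq>{..<d}. card S = Suc k \<or> card S = k \<longrightarrow> c (p + z * sum b S) = i)"
proof (rule ccontr)
  assume no_layer: "\<not> ?thesis"
  have no_layer: False
    if "generic b" "cmod z = 1"
      "\<And>S. S \<subseteq> {..<d} \<Longrightarrow> card S = Suc k \<or> card S = k \<Longrightarrow> c (p + z * sum b S) = i"
    for b p z i
    by (rule notE[OF no_layer], rule exI[of _ b], rule exI[of _ p], rule exI[of _ z],
        rule exI[of _ i]) (intro conjI allI impI that)
  obtain a where a: "generic a" using exists_generic by blast
  define \<omega> where "\<omega> = Complex (1/2) (sqrt 3 / 2)"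
  have \<omega>: "cmod \<omega> = 1" "cmod (1 - \<omega>) = 1" "\<omega> \<noteq> 1"
    by (auto simp: \<omega>_def cmod_def power2_eq_square complex_eq_iff)
  \<comment> \<open>The length of a padded word with \<open>d\<close> letters; no longer word
    occurs, so \<open>W\<close> is finite.\<close>
  define K where "K = d * (2 * k + 1) + k"
  define W where "W = {w. set w \<subseteq> {1, \<omega>} \<and> length w \<le> K}"
  have "finite W" unfolding W_def by (intro finite_lists_length_le) auto
  then obtain h :: "nat \<Rightarrow> nat" and t where h: "strict_mono h" and
    t: "\<And>w xs. w \<in> W \<Longrightarrow> sorted_wrt (<) xs \<Longrightarrow> length xs = length w \<Longrightarrow>
          c (word_sum a w (map h xs)) = t w"
    using infinite_ramsey_words[of "\<lambda>w xs. c (word_sum a w xs)" 2 W] c by metis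
  define b where "b = a \<circ> h"
  have b: "generic b"
    unfolding b_def using a h by (intro generic_comp) (auto intro: strict_mono_imp_inj_on)
  have tb: "c (word_sum b w xs) = t w"
    if "w \<in> W" "sorted_wrt (<) xs" "length xs = length w" for w xs
    using t[OF that] by (simp add: word_sum_map b_def)
  have t2: "t w < 2" if "w \<in> W" for w
    using tb[OF that, of "[0..<length w]"] c by (metis diff_zero length_upt sorted_wrt_upt)
  have flip: "t (u @ replicate (Suc k) z @ v) + t (u @ replicate k z @ v) = 1"
    if z: "z \<in> {1, \<omega>}" and uv: "set u \<subseteq> {1, \<omega>}" "set v \<subseteq> {1, \<omega>}" "length u + Suc k + length v \<le> K"
    for u z v
  proof -
    let ?w = "\<lambda>j. u @ replicate j z @ v"
    have W: "?w j \<in> W" if "j \<le> Suc k" for j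
      using z uv that by (auto simp: W_def)
    \<comment> \<open>The run of \<open>z\<close> draws its indices from a window of length
      \<open>d\<close> between those used for \<open>u\<close> and those used for \<open>v\<close>.
      A subset \<open>S\<close> of the window gives a cube vertex whose color depends only on
      \<open>card S\<close>, so equal colors for the sizes \<open>Suc k\<close> and \<open>k\<close>
      would be a monochromatic layer.\<close>
    define b' where "b' = b \<circ> (\<lambda>i. length u + i)"
    have b': "generic b'" unfolding b'_def using b by (intro generic_comp) (auto simp: inj_def)
    define q where "q = word_sum b u [0..<length u] +
      word_sum b v [length u + d..<length u + d + length v]"
    have c_eq: "c (q + z * sum b' S) = t (?w (card S))" if S: "S \<subseteq> {..<d}" "card S \<le> Suc k" for S
    proof -
      have fin: "finite S" using S(1) finite_subset by blast
      let ?s = "map (\<lambda>i. length u + i) (sorted_list_of_set S)"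
      let ?xs = "[0..<length u] @ ?s @ [length u + d..<length u + d + length v]"
      have "sorted_wrt (<) ?s"
        by (simp add: sorted_wrt_map)
      then have "sorted_wrt (<) ?xs"
        using S(1) fin by (fastforce simp: sorted_wrt_append)
      moreover have "length ?s = card S" by simp
      moreover have "word_sum b (?w (length ?s)) ?xs = q + z * (\<Sum>i\<leftarrow>?s. b i)"
        by (subst word_sum_append, simp, subst word_sum_append, simp, subst word_sum_replicate)
          (simp add: q_def)
      moreover have "(\<Sum>i\<leftarrow>?s. b i) = sum b' S"
        using fin by (simp add: sum_list_distinct_conv_sum_set b'_def o_def)
      ultimately show ?thesis
        using tb[OF W[OF S(2)], of ?xs] by simp
    qed
    have "t (?w (Suc k)) \<noteq> t (?w k)"
    proof
      assume "t (?w (Suc k)) = t (?w k)"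
      then show False
        using z \<omega>(1) c_eq by (intro no_layer[OF b', of z q "t (?w k)"]) auto
    qed
    then show ?thesis using t2[OF W, of "Suc k"] t2[OF W, of k] by linarith
  qed
  define word where "word S = padded_word k \<omega> (map (\<lambda>i. if i \<in> S then 1 else \<omega>) [0..<d])" for S
  have word: "word S \<in> W" "t (word S) = t (word {})" "length (word S) = K" for S
    unfolding word_def
    using set_padded_word[of k \<omega> "map (\<lambda>i. if i \<in> S then 1 else \<omega>) [0..<d]"]
      padded_word_color_eq[of \<omega> k K t "map (\<lambda>i. if i \<in> S then 1 else \<omega>) [0..<d]"
        "map (\<lambda>i. if i \<in> {} then 1 else \<omega>) [0..<d]" "[]"] flip
    by (auto simp: W_def K_def)
  \<comment> \<open>These are the indices met by the \<open>d\<close> free letters.\<close>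
  define b' where "b' = b \<circ> (\<lambda>i. 2 * k + i * (2 * k + 1))"
  have b': "generic b'" unfolding b'_def using b
    by (intro generic_comp) (auto simp: inj_def simp del: mult_Suc_right)
  define q where "q = word_sum b (word {}) [0..<K]"
  have "c (q + (1 - \<omega>) * sum b' S) = t (word {})" if S: "S \<subseteq> {..<d}" for S
  proof -
    have "word_sum b (word S) [0..<K] =
        q + (\<Sum>i<d. ((if i \<in> S then 1 else \<omega>) - \<omega>) * b' i)"
      using word_sum_padded_word[of b k \<omega> "map (\<lambda>i. if i \<in> S then 1 else \<omega>) [0..<d]" 0]
      by (simp add: word_def q_def K_def b'_def map_replicate_const o_def)
    also have "(\<Sum>i<d. ((if i \<in> S then 1 else \<omega>) - \<omega>) * b' i) = (\<Sum>i\<in>S. (1 - \<omega>) * b' i)"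
      using S by (intro sum.mono_neutral_cong_right) auto
    also have "\<dots> = (1 - \<omega>) * sum b' S" by (simp add: sum_distrib_left)
    finally show ?thesis
      using tb[OF word(1), of "[0..<K]" S] word(2,3) by simp
  qed
  then show False by (rule no_layer[OF b' \<omega>(2)])
qed

section \<open>Layered graphs\<close>

text \<open>A library isomorphism maps vertices and arcs separately. Tail and head in
  \<open>with_proj\<close> graphs are \<open>fst\<close> and \<open>snd\<close>, so the vertex map
  determines the arc map.\<close>

lemma digraph_isoE:
  assumes "digraph_iso (with_proj H) (with_proj L)"
  obtains g where "inj_on g (pverts H)" "g ` pverts H = pverts L"
    "\<And>u v. u \<in> pverts H \<Longrightarrow> v \<in> pverts H \<Longrightarrow> (u, v) \<in> parcs H \<longleftrightarrow> (g u, g v) \<in> parcs L"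
proof -
  from assms obtain f where iso: "pre_digraph.digraph_isomorphism (with_proj H) f"
    and L: "with_proj L = app_iso f (with_proj H)"
    unfolding digraph_iso_def by blast
  let ?g = "iso_verts f"
  have wf: "pair_wf_digraph H"
    using iso by (simp add: pre_digraph.digraph_isomorphism_def wf_digraph_wp_iff)
  have inj: "inj_on ?g (pverts H)"
    using iso by (simp add: pre_digraph.digraph_isomorphism_def)
  have verts: "pverts L = ?g ` pverts H" and arcs: "parcs L = iso_arcs f ` parcs H"
    using arg_cong[OF L, of verts] arg_cong[OF L, of arcs] by simp_all
  have "fst = iso_tail f" "snd = iso_head f"
    using arg_cong[OF L, of tail] arg_cong[OF L, of head] by simp_all
  then have ends: "iso_arcs f e = (?g (fst e), ?g (snd e))" if "e \<in> parcs H" for e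
    using iso that by (simp add: pre_digraph.digraph_isomorphism_def prod_eq_iff)
  have "(u, v) \<in> parcs H \<longleftrightarrow> (?g u, ?g v) \<in> parcs L" if uv: "u \<in> pverts H" "v \<in> pverts H" for u v
  proof
    assume "(u, v) \<in> parcs H"
    then show "(?g u, ?g v) \<in> parcs L" using ends[of "(u, v)"] arcs by (auto intro: rev_image_eqI)
  next
    assume "(?g u, ?g v) \<in> parcs L"
    then obtain e where e: "e \<in> parcs H" "(?g u, ?g v) = iso_arcs f e" using arcs by blast
    then have "?g u = ?g (fst e)" "?g v = ?g (snd e)" using ends by auto
    moreover have "fst e \<in> pverts H" "snd e \<in> pverts H"
      using pair_wf_digraph.arc_fst_in_verts[OF wf e(1)] pair_wf_digraph.arc_snd_in_verts[OF wf e(1)] .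
    ultimately have "u = fst e" "v = snd e" using inj uv by (auto dest: inj_onD)
    then show "(u, v) \<in> parcs H" using e(1) by simp
  qed
  then show ?thesis using that inj verts by metis
qed

text \<open>The equivalence for unit distance serves both kinds of copies: subgraphs use one
  direction, induced subgraphs use both.\<close>

lemma exists_monochromatic_edge_layer:
  assumes "plane_coloring r c" "r \<le> 2" "1 \<le> k"
  obtains f i where "inj_on f (pverts (edge_layer d k))"
    "\<And>x y. x \<in> pverts (edge_layer d k) \<Longrightarrow> y \<in> pverts (edge_layer d k) \<Longrightarrow>
       norm (f x - f y) = 1 \<longleftrightarrow> (x, y) \<in> parcs (edge_layer d k)"
    "\<And>x. x \<in> pverts (edge_layer d k) \<Longrightarrow> c (f x) = i"
proof -
  obtain k' where k: "k = Suc k'" using \<open>1 \<le> k\<close> by (cases k) auto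
  have "c (plane_of_complex z) < 2" for z
    using assms(1,2) unfolding plane_coloring_def by (meson less_le_trans)
  from exists_monochromatic_layer[of "\<lambda>z. c (plane_of_complex z)", OF this, of d k']
  obtain b p z i where b: "generic b" "cmod z = 1" and mono: "\<forall>S\<subseteq>{..<d}. card S = Suc k' \<or> card S = k' \<longrightarrow>
      c (plane_of_complex (p + z * sum b S)) = i"
    by blast
  let ?f = "cube_embedding b p z"
  have V: "x \<in> pverts (hypercube d)" "card (support x) = Suc k' \<or> card (support x) = k'"
    if "x \<in> pverts (edge_layer d k)" for x
    using that by (auto simp: edge_layer_def Let_def k num_ones_eq_card_support)
  show ?thesis
  proof
    show "inj_on ?f (pverts (edge_layer d k))"
      using inj_on_cube_embedding[OF b] V(1) by (meson inj_on_subset subsetI)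
    show "norm (?f x - ?f y) = 1 \<longleftrightarrow> (x, y) \<in> parcs (edge_layer d k)"
      if "x \<in> pverts (edge_layer d k)" "y \<in> pverts (edge_layer d k)" for x y
      using that by (simp add: cube_embedding_unit_iff[OF b V(1) V(1)]) (simp add: edge_layer_def Let_def)
    show "c (?f x) = i" if "x \<in> pverts (edge_layer d k)" for x
      using mono V(2)[OF that] support_subset[OF V(1)[OF that]] unfolding cube_embedding_def by blast
  qed
qed

lemma layered_monochromatic_unit_copy:
  assumes "layered H" "plane_coloring r c" "r \<le> 2"
  shows "\<exists>A. unit_copy H A \<and> monochromatic c A"
proof -
  from assms(1) obtain d k L where k: "1 \<le> k"
    and sub: "subgraph (with_proj L) (with_proj (edge_layer d k))"
    and iso: "digraph_iso (with_proj H) (with_proj L)"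
    unfolding layered_def by blast
  obtain g where g: "inj_on g (pverts H)" "g ` pverts H = pverts L"
    "\<And>u v. u \<in> pverts H \<Longrightarrow> v \<in> pverts H \<Longrightarrow> (u, v) \<in> parcs H \<longleftrightarrow> (g u, g v) \<in> parcs L"
    using digraph_isoE[OF iso] by blast
  obtain f i where f: "inj_on f (pverts (edge_layer d k))"
    "\<And>x y. x \<in> pverts (edge_layer d k) \<Longrightarrow> y \<in> pverts (edge_layer d k) \<Longrightarrow>
       norm (f x - f y) = 1 \<longleftrightarrow> (x, y) \<in> parcs (edge_layer d k)"
    "\<And>x. x \<in> pverts (edge_layer d k) \<Longrightarrow> c (f x) = i"
    using exists_monochromatic_edge_layer[OF assms(2,3) k] by metis
  have L: "pverts L \<subseteq> pverts (edge_layer d k)" "parcs L \<subseteq> parcs (edge_layer d k)"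
    using sub by (auto simp: subgraph_def)
  have gV: "g u \<in> pverts (edge_layer d k)" if "u \<in> pverts H" for u using that g(2) L(1) by blast
  have "inj_on (f \<circ> g) (pverts H)"
    using g(1,2) L(1) f(1) by (intro comp_inj_on) (auto intro: inj_on_subset)
  moreover have "norm ((f \<circ> g) u - (f \<circ> g) v) = 1"
    if "u \<in> pverts H" "v \<in> pverts H" "(u, v) \<in> parcs H" for u v
    using f(2)[OF gV gV] g(3) L(2) that by auto
  ultimately have "unit_copy H ((f \<circ> g) ` pverts H)"
    unfolding unit_copy_def by (intro exI[of _ "f \<circ> g"]) (simp add: bij_betw_def image_comp)
  moreover have "monochromatic c ((f \<circ> g) ` pverts H)"
    unfolding monochromatic_def using f(3) gV by auto
  ultimately show ?thesis by blast
qed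

lemma induced_layered_monochromatic_unit_copy:
  assumes "induced_layered H" "plane_coloring r c" "r \<le> 2"
  shows "\<exists>A. induced_unit_copy H A \<and> monochromatic c A"
proof -
  from assms(1) obtain d k L where k: "1 \<le> k"
    and sub: "induced_subgraph (with_proj L) (with_proj (edge_layer d k))"
    and iso: "digraph_iso (with_proj H) (with_proj L)"
    unfolding induced_layered_def by blast
  obtain g where g: "inj_on g (pverts H)" "g ` pverts H = pverts L"
    "\<And>u v. u \<in> pverts H \<Longrightarrow> v \<in> pverts H \<Longrightarrow> (u, v) \<in> parcs H \<longleftrightarrow> (g u, g v) \<in> parcs L"
    using digraph_isoE[OF iso] by blast
  obtain f i where f: "inj_on f (pverts (edge_layer d k))"
    "\<And>x y. x \<in> pverts (edge_layer d k) \<Longrightarrow> y \<in> pverts (edge_layer d k) \<Longrightarrow>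
       norm (f x - f y) = 1 \<longleftrightarrow> (x, y) \<in> parcs (edge_layer d k)"
    "\<And>x. x \<in> pverts (edge_layer d k) \<Longrightarrow> c (f x) = i"
    using exists_monochromatic_edge_layer[OF assms(2,3) k] by metis
  have L: "pverts L \<subseteq> pverts (edge_layer d k)"
    "parcs L = {e \<in> parcs (edge_layer d k). fst e \<in> pverts L \<and> snd e \<in> pverts L}"
    using sub by (auto simp: induced_subgraph_def subgraph_def)
  have gV: "g u \<in> pverts (edge_layer d k)" "g u \<in> pverts L" if "u \<in> pverts H" for u
    using that g(2) L(1) by blast+
  have "inj_on (f \<circ> g) (pverts H)"
    using g(1,2) L(1) f(1) by (intro comp_inj_on) (auto intro: inj_on_subset)
  moreover have "norm ((f \<circ> g) u - (f \<circ> g) v) = 1 \<longleftrightarrow> (u, v) \<in> parcs H"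
    if uv: "u \<in> pverts H" "v \<in> pverts H" for u v
  proof -
    have "(g u, g v) \<in> parcs (edge_layer d k) \<longleftrightarrow> (g u, g v) \<in> parcs L"
      using gV(2)[OF uv(1)] gV(2)[OF uv(2)] by (subst L(2)) simp
    then show ?thesis using f(2)[OF gV(1)[OF uv(1)] gV(1)[OF uv(2)]] g(3)[OF uv] by simp
  qed
  ultimately have "induced_unit_copy H ((f \<circ> g) ` pverts H)"
    unfolding induced_unit_copy_def by (intro exI[of _ "f \<circ> g"]) (simp add: bij_betw_def image_comp)
  moreover have "monochromatic c ((f \<circ> g) ` pverts H)"
    unfolding monochromatic_def using f(3) gV by auto
  ultimately show ?thesis by blast
qed

text \<open>Strictness survives the infimum because the values are integers: all are at least
  \<open>Suc n\<close>. The empty set has infimum \<open>\<infinity>\<close>.\<close>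

lemma less_Inf_enat:
  assumes "\<And>r. P r \<Longrightarrow> n < r"
  shows "enat n < Inf {enat r |r. P r}"
proof -
  have "enat (Suc n) \<le> Inf {enat r |r. P r}"
    using assms by (auto intro!: Inf_greatest simp: Suc_le_eq)
  then show ?thesis by (metis enat_ord_simps(2) lessI less_le_trans)
qed

lemma layered_chi_plane: "layered H \<Longrightarrow> chi_plane H > 2"
  unfolding chi_plane_def numeral_eq_enat
  by (intro less_Inf_enat) (metis layered_monochromatic_unit_copy not_le)

lemma induced_layered_chi_ind_plane: "induced_layered H \<Longrightarrow> chi_ind_plane H > 2"
  unfolding chi_ind_plane_def numeral_eq_enat
  by (intro less_Inf_enat) (metis induced_layered_monochromatic_unit_copy not_le)

text \<open>This serves the lower bound on \<open>chi_plane\<close>: without any copy, a single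
  color would do.\<close>

lemma exists_unit_copy_hypercube: "\<exists>A. unit_copy (hypercube d) A"
proof -
  obtain b where b: "generic b" using exists_generic by blast
  let ?f = "cube_embedding b 0 1"
  have "unit_copy (hypercube d) (?f ` pverts (hypercube d))"
    unfolding unit_copy_def
    using inj_on_cube_embedding[OF b, of 1 0 d] cube_embedding_unit_iff[OF b, of 1 _ d _ 0]
    by (intro exI[of _ ?f]) (simp add: inj_on_imp_bij_betw)
  then show ?thesis by blast
qed

lemma chi_plane_hypercube_ge: "2 \<le> chi_plane (hypercube d)"
proof -
  obtain A where A: "unit_copy (hypercube d) A" using exists_unit_copy_hypercube by blast
  have "1 < r" if c: "plane_coloring r c" and no: "\<not> (\<exists>A. unit_copy (hypercube d) A \<and> monochromatic c A)" for r c
  proof (rule ccontr)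
    assume "\<not> 1 < r"
    then have "c x = 0" for x using c unfolding plane_coloring_def by (metis less_one less_trans nat_neq_iff)
    then show False using no A unfolding monochromatic_def by auto
  qed
  then have "enat 1 < chi_plane (hypercube d)"
    unfolding chi_plane_def by (intro less_Inf_enat) blast
  then show ?thesis by (metis Suc_1 Suc_ile_eq numeral_eq_enat)
qed

section \<open>The zigzag coloring\<close>

lemma norm_real2: "(norm (z :: real^2))\<^sup>2 = (z $ 1)\<^sup>2 + (z $ 2)\<^sup>2"
  unfolding norm_vec_def L2_set_def by (simp add: UNIV_2)

text \<open>Both \<open>r = q - p\<close> and \<open>m = q - (u + v - p)\<close> are perpendicular
  to the nonzero vector \<open>u - v\<close>, hence parallel. They are also perpendicular to each
  other, and \<open>r\<close> is nonzero, so \<open>m = 0\<close>.\<close>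

lemma unit_rhombus:
  fixes p q u v :: "real^2"
  assumes "norm (u - p) = 1" "norm (v - p) = 1" "norm (q - u) = 1" "norm (q - v) = 1"
    and "u \<noteq> v" "p \<noteq> q"
  shows "q = u + v - p"
proof -
  define a1 a2 b1 b2 r1 r2 where defs: "a1 = (u - p) $ 1" "a2 = (u - p) $ 2"
    "b1 = (v - p) $ 1" "b2 = (v - p) $ 2" "r1 = (q - p) $ 1" "r2 = (q - p) $ 2"
  define m1 m2 where m: "m1 = r1 - (a1 + b1)" "m2 = r2 - (a2 + b2)"
  have sq: "a1\<^sup>2 + a2\<^sup>2 = 1" "b1\<^sup>2 + b2\<^sup>2 = 1"
      "(r1 - a1)\<^sup>2 + (r2 - a2)\<^sup>2 = 1" "(r1 - b1)\<^sup>2 + (r2 - b2)\<^sup>2 = 1"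
    using norm_real2[of "u - p"] norm_real2[of "v - p"] norm_real2[of "q - u"] norm_real2[of "q - v"] assms
    by (simp_all add: defs)
  have ra: "2 * (r1 * a1 + r2 * a2) = r1\<^sup>2 + r2\<^sup>2" and rb: "2 * (r1 * b1 + r2 * b2) = r1\<^sup>2 + r2\<^sup>2"
    using sq by (simp_all add: power2_eq_square algebra_simps)
  have e: "a1 - b1 \<noteq> 0 \<or> a2 - b2 \<noteq> 0"
    using \<open>u \<noteq> v\<close> by (auto simp: defs vec_eq_iff forall_2)
  have r0: "r1\<^sup>2 + r2\<^sup>2 \<noteq> 0"
    using \<open>p \<noteq> q\<close> by (auto simp: defs vec_eq_iff forall_2 sum_power2_eq_zero_iff)
  have re: "r1 * (a1 - b1) + r2 * (a2 - b2) = 0"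
    using ra rb by (simp add: algebra_simps)
  have me: "m1 * (a1 - b1) + m2 * (a2 - b2) = 0"
    using re sq(1,2) by (simp add: m power2_eq_square algebra_simps)
  have rm: "r1 * m1 + r2 * m2 = 0"
    using ra rb by (simp add: m power2_eq_square algebra_simps)
  have "(r1 * m2 - r2 * m1) * (a1 - b1) = 0" "(r1 * m2 - r2 * m1) * (a2 - b2) = 0"
    using re me by algebra+
  then have "r1 * m2 - r2 * m1 = 0" using e by auto
  then have "(r1\<^sup>2 + r2\<^sup>2) * (m1\<^sup>2 + m2\<^sup>2) = 0" using rm by algebra
  then have "m1 = 0" "m2 = 0" using r0 by (auto simp: sum_power2_eq_zero_iff)
  then show ?thesis by (simp add: m defs vec_eq_iff forall_2)
qed

text \<open>The sets \<open>R\<close>, \<open>insert i R\<close>, \<open>insert j R\<close> and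
  \<open>insert i (insert j R)\<close> form a 4-cycle of unit edges, and injectivity keeps opposite
  corners distinct. So \<open>unit_rhombus\<close> applies, and induction on the size of
  \<open>S\<close> adds up the steps.\<close>

lemma unit_cube_affine:
  fixes g :: "'i set \<Rightarrow> real^2"
  assumes inj: "inj_on g (Pow D)"
    and unit: "\<And>S i. insert i S \<subseteq> D \<Longrightarrow> i \<notin> S \<Longrightarrow> norm (g (insert i S) - g S) = 1"
    and "S \<subseteq> D" "finite S"
  shows "g S = g {} + (\<Sum>i\<in>S. g {i} - g {})"
  using assms(4,3)
proof (induction "card S" arbitrary: S rule: less_induct)
  case less
  show ?case
  proof (cases "\<exists>i j R. S = insert i (insert j R) \<and> i \<noteq> j \<and> i \<notin> R \<and> j \<notin> R")
    case True
    then obtain i j R where S: "S = insert i (insert j R)" "i \<noteq> j" "i \<notin> R" "j \<notin> R" by blast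
    have fin: "finite R" using less.prems(1) S(1) by simp
    have sub: "insert i (insert j R) \<subseteq> D" using less.prems(2) S(1) by simp
    have IH: "g R = g {} + (\<Sum>i\<in>R. g {i} - g {})"
      "g (insert i R) = g {} + (\<Sum>i\<in>insert i R. g {i} - g {})"
      "g (insert j R) = g {} + (\<Sum>i\<in>insert j R. g {i} - g {})"
      using sub fin S by (intro less.hyps; simp)+
    have "g S = g (insert i R) + g (insert j R) - g R"
    proof (rule unit_rhombus)
      show "norm (g (insert i R) - g R) = 1" "norm (g (insert j R) - g R) = 1"
        using sub S by (auto intro!: unit)
      show "norm (g S - g (insert j R)) = 1"
        unfolding S(1) using sub S by (intro unit) auto
      show "norm (g S - g (insert i R)) = 1"
        unfolding S(1) insert_commute[of i j] using sub S by (intro unit) auto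
      have "insert i R \<noteq> insert j R" "R \<noteq> S" using S by auto
      then show "g (insert i R) \<noteq> g (insert j R)" "g R \<noteq> g S"
        using sub S(1) by (auto dest!: inj_onD[OF inj])
    qed
    then show ?thesis using fin S by (simp add: IH)
  next
    case False
    have "S = {} \<or> (\<exists>i. S = {i})"
    proof (rule ccontr)
      assume "\<not> ?thesis"
      then obtain i j where "i \<in> S" "j \<in> S" "i \<noteq> j" by blast
      then have "S = insert i (insert j (S - {i, j}))" by blast
      then show False using False \<open>i \<noteq> j\<close> by blast
    qed
    then show ?thesis by auto
  qed
qed

section \<open>The triangle wave and the coloring built on it\<close>

definition triangle_wave :: "real \<Rightarrow> real" where
  "triangle_wave y = \<bar>y - 6 * of_int (round (y / 6))\<bar>"

lemma triangle_wave_le: "triangle_wave y \<le> \<bar>y - 6 * of_int m\<bar>"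
proof -
  have "\<bar>y / 6 - of_int (round (y / 6))\<bar> \<le> \<bar>y / 6 - of_int m\<bar>"
    by (rule round_diff_minimal)
  then show ?thesis unfolding triangle_wave_def by linarith
qed

text \<open>The wave is the distance to the nearest multiple of 6, and each value is at most the
  distance to the multiple nearest to the other point.\<close>

lemma triangle_wave_lipschitz: "\<bar>triangle_wave y - triangle_wave y'\<bar> \<le> \<bar>y - y'\<bar>"
  using triangle_wave_le[of y "round (y' / 6)"] triangle_wave_le[of y' "round (y / 6)"]
  unfolding triangle_wave_def by linarith

lemma triangle_wave_up:
  assumes "6 * of_int m \<le> y" "y \<le> 6 * of_int m + 3"
  shows "triangle_wave y = y - 6 * of_int m"
proof -
  \<comment> \<open>At \<open>y = 6 * m + 3\<close> the rounding goes up, but both multiples are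
    then equally near.\<close>
  have "round (y / 6) = m \<or> round (y / 6) = m + 1"
    using assms unfolding round_def by linarith
  moreover have "y = 6 * of_int m + 3" if "round (y / 6) = m + 1"
    using assms that unfolding round_def by linarith
  ultimately show ?thesis using assms unfolding triangle_wave_def by auto
qed

lemma triangle_wave_down:
  assumes "6 * of_int m + 3 \<le> y" "y \<le> 6 * of_int m + 6"
  shows "triangle_wave y = 6 * of_int m + 6 - y"
proof -
  have "round (y / 6) = m + 1"
    using assms unfolding round_def by linarith
  then show ?thesis using assms unfolding triangle_wave_def by auto
qed

definition zigzag :: "real^2 \<Rightarrow> real" where
  "zigzag z = z $ 1 + triangle_wave (z $ 2)"

definition zigzag_coloring :: "real^2 \<Rightarrow> nat" where
  "zigzag_coloring z = nat (\<lfloor>zigzag z / sqrt 2\<rfloor> mod 2)"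

lemma zigzag_unit_step:
  assumes "norm (z - w) = 1"
  shows "\<bar>zigzag z - zigzag w\<bar> \<le> sqrt 2"
proof -
  define a b where "a = z $ 1 - w $ 1" and "b = z $ 2 - w $ 2"
  have "a\<^sup>2 + b\<^sup>2 = 1" using norm_real2[of "z - w"] assms by (simp add: a_def b_def)
  moreover have "(\<bar>a\<bar> + \<bar>b\<bar>)\<^sup>2 + (\<bar>a\<bar> - \<bar>b\<bar>)\<^sup>2 = 2 * (a\<^sup>2 + b\<^sup>2)"
    by (simp add: power2_eq_square algebra_simps)
  ultimately have "(\<bar>a\<bar> + \<bar>b\<bar>)\<^sup>2 = 2 - (\<bar>a\<bar> - \<bar>b\<bar>)\<^sup>2" by simp
  then have "(\<bar>a\<bar> + \<bar>b\<bar>)\<^sup>2 \<le> 2" by simp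
  then have "\<bar>a\<bar> + \<bar>b\<bar> \<le> sqrt 2" by (rule real_le_rsqrt)
  then show ?thesis
    using triangle_wave_lipschitz[of "z $ 2" "w $ 2"] unfolding zigzag_def a_def b_def by linarith
qed

text \<open>After division by \<open>sqrt 2\<close> a unit step moves the value by at most 1, hence
  its floor by at most 1, and equal parity leaves only equal floors.\<close>

lemma zigzag_coloring_eq_imp_floor_eq:
  assumes "norm (z - w) = 1" "zigzag_coloring z = zigzag_coloring w"
  shows "\<lfloor>zigzag z / sqrt 2\<rfloor> = \<lfloor>zigzag w / sqrt 2\<rfloor>"
proof -
  have "\<bar>zigzag z / sqrt 2 - zigzag w / sqrt 2\<bar> = \<bar>zigzag z - zigzag w\<bar> / sqrt 2"
    by (simp flip: diff_divide_distrib)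
  also have "\<dots> \<le> 1" using zigzag_unit_step[OF assms(1)] by simp
  finally have "\<bar>\<lfloor>zigzag z / sqrt 2\<rfloor> - \<lfloor>zigzag w / sqrt 2\<rfloor>\<bar> \<le> 1" by linarith
  moreover have "\<lfloor>zigzag z / sqrt 2\<rfloor> mod 2 = \<lfloor>zigzag w / sqrt 2\<rfloor> mod 2"
    using assms(2) by (simp add: zigzag_coloring_def)
  ultimately show ?thesis by presburger
qed

section \<open>Heights reached by sums of unit vectors\<close>

lemma subset_sum_in_unit_interval:
  fixes y :: "'i \<Rightarrow> real"
  assumes "finite I" "\<And>k. k \<in> I \<Longrightarrow> y k \<le> 1" "0 \<le> s" "s \<le> sum y I"
  shows "\<exists>J\<subseteq>I. s \<le> sum y J \<and> sum y J \<le> s + 1"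
  using assms
proof (induction I)
  case empty
  then show ?case by auto
next
  case (insert k I)
  show ?case
  proof (cases "s \<le> sum y I")
    case True
    then show ?thesis using insert by (meson insertCI subset_insertI2)
  next
    case False
    \<comment> \<open>Adding \<open>k\<close> lifts the sum from below \<open>s\<close>, so it
      overshoots by no more than \<open>y k \<le> 1\<close>.\<close>
    then have "sum y (insert k I) \<le> s + 1"
      using insert.hyps insert.prems(1)[of k] by simp
    then show ?thesis using insert.prems(3) by blast
  qed
qed

text \<open>Strips of height 1 repeat with period 6, leaving gaps of 5. The integer \<open>m\<close>
  marks the first strip not entirely below \<open>y0\<close>: either \<open>y0\<close> lies in it,
  or a subset of \<open>I\<close> reaches it with an overshoot that the height of the strip
  absorbs.\<close>

lemma walk_into_strip:
  fixes y :: "'i \<Rightarrow> real"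
  assumes "finite I" "\<And>k. k \<in> I \<Longrightarrow> y k \<le> 1" "5 \<le> sum y I"
  shows "\<exists>J\<subseteq>I. \<exists>m::int. A + 6 * m \<le> y0 + sum y J \<and> y0 + sum y J \<le> A + 6 * m + 1"
proof -
  define m where "m = \<lceil>(y0 - A - 1) / 6\<rceil>"
  have "(y0 - A - 1) / 6 \<le> of_int m" "of_int m < (y0 - A - 1) / 6 + 1"
    unfolding m_def by linarith+
  then have m: "y0 \<le> A + 6 * m + 1" "A + 6 * m < y0 + 5"
    by (simp_all add: field_simps)
  show ?thesis
  proof (cases "A + 6 * m \<le> y0")
    case True
    then show ?thesis using m by (intro exI[of _ "{}"] conjI exI[of _ m]) auto
  next
    case False
    then obtain J where "J \<subseteq> I" "A + 6 * m - y0 \<le> sum y J" "sum y J \<le> A + 6 * m - y0 + 1"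
      using subset_sum_in_unit_interval[of I y "A + 6 * m - y0"] assms m by auto
    then show ?thesis by (intro exI[of _ J] conjI exI[of _ m]) auto
  qed
qed

text \<open>Up to 45 degrees the unit arc lies beyond the chord
  \<open>x + (sqrt 2 - 1) * y = 1\<close> from \<open>(1, 0)\<close> to
  \<open>(1, 1) / sqrt 2\<close>. A flat vector pays for its lack of height with
  \<open>x - y\<close>, a lower bound for the change of \<open>zigzag\<close> it causes.\<close>

lemma unit_vector_chord:
  fixes x y :: real
  assumes "x\<^sup>2 + y\<^sup>2 = 1" "0 \<le> y" "y \<le> x"
  shows "1 - (x - y) \<le> sqrt 2 * y"
proof -
  have "1 \<le> x + (sqrt 2 - 1) * y"
  proof (rule power2_le_imp_le)
    have "0 \<le> (sqrt 2 - 1) * y * (x - y)"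
      using assms by simp
    moreover have "(x + (sqrt 2 - 1) * y)\<^sup>2 = x\<^sup>2 + y\<^sup>2 + 2 * ((sqrt 2 - 1) * y * (x - y))"
      by (simp add: power2_eq_square algebra_simps)
    ultimately show "1\<^sup>2 \<le> (x + (sqrt 2 - 1) * y)\<^sup>2" using assms(1) by simp
    show "0 \<le> x + (sqrt 2 - 1) * y" using assms by simp
  qed
  then show ?thesis by (simp add: algebra_simps)
qed

lemma unit_vector_steep:
  fixes x y :: real
  assumes "x\<^sup>2 + y\<^sup>2 = 1" "0 \<le> y" "\<bar>x\<bar> \<le> y"
  shows "1 \<le> sqrt 2 * y"
proof (rule power2_le_imp_le)
  have "x\<^sup>2 \<le> y\<^sup>2" using assms(2,3) by (metis abs_le_square_iff abs_of_nonneg)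
  then show "1\<^sup>2 \<le> (sqrt 2 * y)\<^sup>2" using assms(1) by (simp add: power_mult_distrib)
qed (use assms in simp)

lemma unit_vector_coordinate_sum:
  fixes x y :: real
  assumes "x\<^sup>2 + y\<^sup>2 = 1" "0 \<le> y" "0 \<le> x"
  shows "1 \<le> x + y"
proof (rule power2_le_imp_le)
  show "1\<^sup>2 \<le> (x + y)\<^sup>2"
    using assms by (simp add: power2_sum)
qed (use assms in simp)

lemma zigzag_cube_upward:
  fixes v :: "nat \<Rightarrow> real^2"
  assumes unit: "\<And>k. k < 11 \<Longrightarrow> norm (v k) = 1" and up: "\<And>k. k < 11 \<Longrightarrow> 0 \<le> v k $ 2"
    and const: "\<And>S. S \<subseteq> {..<11} \<Longrightarrow> \<lfloor>zigzag (q + sum v S) / sqrt 2\<rfloor> = n"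
  shows False
proof -
  define x y where "x k = v k $ 1" and "y k = v k $ 2" for k
  have xy: "(x k)\<^sup>2 + (y k)\<^sup>2 = 1" "0 \<le> y k" "y k \<le> 1" if "k < 11" for k
  proof -
    show "(x k)\<^sup>2 + (y k)\<^sup>2 = 1" using norm_real2[of "v k"] unit[OF that] by (simp add: x_def y_def)
    show "0 \<le> y k" using up[OF that] by (simp add: y_def)
    show "y k \<le> 1" using component_le_norm_cart[of "v k" 2] unit[OF that] by (simp add: y_def)
  qed
  have zz: "zigzag (q + sum v S) = q $ 1 + sum x S + triangle_wave (q $ 2 + sum y S)" for S
    by (simp add: zigzag_def x_def y_def)
  \<comment> \<open>Strict, because the intervals of equal floor are half-open.\<close>
  have osc: "zigzag (q + sum v S) - zigzag (q + sum v T) < sqrt 2"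
    if "S \<subseteq> {..<11}" "T \<subseteq> {..<11}" for S T
  proof -
    have "zigzag (q + sum v S) / sqrt 2 < of_int n + 1" "of_int n \<le> zigzag (q + sum v T) / sqrt 2"
      using const[OF that(1)] const[OF that(2)] by linarith+
    then have "zigzag (q + sum v S) < (of_int n + 1) * sqrt 2" "of_int n * sqrt 2 \<le> zigzag (q + sum v T)"
      by (simp_all add: field_simps)
    then show ?thesis by (simp add: algebra_simps)
  qed
  have "\<exists>i<11. \<exists>j<11. i \<noteq> j \<and> (0 \<le> x i \<and> 0 \<le> x j \<or> x i \<le> 0 \<and> x j \<le> 0)"
  proof -
    have "0 \<le> x 0 \<and> 0 \<le> x 1 \<or> x 0 \<le> 0 \<and> x 1 \<le> 0 \<or> 0 \<le> x 0 \<and> 0 \<le> x 2 \<or> x 0 \<le> 0 \<and> x 2 \<le> 0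
      \<or> 0 \<le> x 1 \<and> 0 \<le> x 2 \<or> x 1 \<le> 0 \<and> x 2 \<le> 0"
      by linarith
    moreover have "(0::nat) < 11" "(1::nat) < 11" "(2::nat) < 11" "(0::nat) \<noteq> 1" "(0::nat) \<noteq> 2" "(1::nat) \<noteq> 2"
      by simp_all
    ultimately show ?thesis by blast
  qed
  then obtain i j where ij: "i < 11" "j < 11" "i \<noteq> j"
    and same_side: "0 \<le> x i \<and> 0 \<le> x j \<or> x i \<le> 0 \<and> x j \<le> 0"
    by blast
  define I where "I = {..<11} - {i, j}"
  have I: "finite I" "I \<subseteq> {..<11}" "card I = 9"
    using ij by (auto simp: I_def card_Diff_subset)
  define R L where "R = {k \<in> I. y k < x k}" and "L = {k \<in> I. y k < - x k}"
  have RL: "finite R" "finite L" "R \<subseteq> {..<11}" "L \<subseteq> {..<11}" "R \<inter> L = {}"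
  proof -
    show "finite R" "finite L" "R \<subseteq> {..<11}" "L \<subseteq> {..<11}"
      using I by (auto simp: R_def L_def)
    have False if "k \<in> R" "k \<in> L" for k
      using that I(2) xy(2)[of k] by (auto simp: R_def L_def)
    then show "R \<inter> L = {}" by blast
  qed
  \<comment> \<open>Comparing the corners \<open>R\<close> and \<open>L\<close> lets the flat
    vectors of both sides add up: the wave takes back at most
    \<open>sum y R + sum y L\<close>.\<close>
  have flat: "(\<Sum>k\<in>R. x k - y k) + (\<Sum>k\<in>L. - x k - y k) < sqrt 2"
  proof -
    have "\<bar>triangle_wave (q $ 2 + sum y R) - triangle_wave (q $ 2 + sum y L)\<bar> \<le> \<bar>sum y R - sum y L\<bar>"
      using triangle_wave_lipschitz[of "q $ 2 + sum y R" "q $ 2 + sum y L"] by simp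
    moreover have "0 \<le> sum y R" "0 \<le> sum y L"
      using RL xy(2) by (auto intro!: sum_nonneg)
    ultimately show ?thesis
      using osc[OF RL(3,4)] unfolding zz by (simp add: sum_subtractf sum_negf)
  qed
  \<comment> \<open>Each of the nine vectors satisfies \<open>1 \<le> sqrt 2 * y k\<close> up to an
    excess, and \<open>flat\<close> bounds the total excess.\<close>
  have "real (card I) - (\<Sum>k\<in>I. if k \<in> R then x k - y k else if k \<in> L then - x k - y k else 0)
      = (\<Sum>k\<in>I. 1 - (if k \<in> R then x k - y k else if k \<in> L then - x k - y k else 0))"
    by (simp add: sum_subtractf)
  also have "\<dots> \<le> (\<Sum>k\<in>I. sqrt 2 * y k)"
  proof (rule sum_mono)
    fix k assume k: "k \<in> I"
    then have k': "k < 11" using I(2) by auto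
    show "1 - (if k \<in> R then x k - y k else if k \<in> L then - x k - y k else 0) \<le> sqrt 2 * y k"
      using unit_vector_chord[of "x k" "y k"] unit_vector_chord[of "- x k" "y k"]
        unit_vector_steep[of "x k" "y k"] xy[OF k'] k
      by (auto simp: R_def L_def)
  qed
  also have "\<dots> = sqrt 2 * sum y I" by (simp add: sum_distrib_left)
  also have "(\<Sum>k\<in>I. if k \<in> R then x k - y k else if k \<in> L then - x k - y k else 0) =
      (\<Sum>k\<in>R. x k - y k) + (\<Sum>k\<in>L. - x k - y k)"
  proof -
    have "(\<Sum>k\<in>I. if k \<in> R then x k - y k else if k \<in> L then - x k - y k else 0) =
        (\<Sum>k\<in>R \<union> L. if k \<in> R then x k - y k else if k \<in> L then - x k - y k else 0)"
      using I(1) by (intro sum.mono_neutral_right) (auto simp: R_def L_def)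
    also have "\<dots> = (\<Sum>k\<in>R. if k \<in> R then x k - y k else if k \<in> L then - x k - y k else 0) +
        (\<Sum>k\<in>L. if k \<in> R then x k - y k else if k \<in> L then - x k - y k else 0)"
      using RL by (intro sum.union_disjoint) auto
    also have "(\<Sum>k\<in>L. if k \<in> R then x k - y k else if k \<in> L then - x k - y k else 0) =
        (\<Sum>k\<in>L. - x k - y k)"
      using RL(5) by (intro sum.cong) auto
    finally show ?thesis by simp
  qed
  finally have "9 - sqrt 2 < sqrt 2 * sum y I" using flat I(3) by simp
  \<comment> \<open>Eight vectors would give only \<open>8 / sqrt 2 - 1\<close>, which is less than
    5; hence the dimension 11 = 9 + 2.\<close>
  moreover have "sqrt 2 * 6 < 9"
    by (rule power2_less_imp_less) (simp_all add: power_mult_distrib)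
  ultimately have "sqrt 2 * 5 < sqrt 2 * sum y I" by linarith
  then have reach: "5 \<le> sum y I" by simp
  have pair: "sum f (insert i (insert j J)) = f i + f j + sum f J" if "J \<subseteq> I" for J and f :: "nat \<Rightarrow> real"
  proof -
    have "finite J" "i \<notin> J" "j \<notin> J" using that I(1) finite_subset by (auto simp: I_def)
    then show ?thesis using ij(3) by simp
  qed
  have sqrt2: "sqrt 2 \<le> 2" by (rule real_le_lsqrt) simp_all
  have y_le: "y k \<le> 1" if "k \<in> I" for k using that I(2) xy(3) by auto
  have strip: thesis
    if "\<And>J m. J \<subseteq> I \<Longrightarrow> A + 6 * of_int m \<le> q $ 2 + sum y J \<Longrightarrow>
      q $ 2 + sum y J \<le> A + 6 * of_int m + 1 \<Longrightarrow> thesis" for A thesis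
    using walk_into_strip[OF I(1) y_le reach, of A "q $ 2"] that by auto
  from same_side show False
  proof
    assume x: "0 \<le> x i \<and> 0 \<le> x j"
    \<comment> \<open>The strip with \<open>A = 0\<close> opens a rising half of length 3. The pair
      climbs at most 2 from there, so it stays in that half.\<close>
    obtain J m where J: "J \<subseteq> I" "0 + 6 * of_int m \<le> q $ 2 + sum y J"
      "q $ 2 + sum y J \<le> 0 + 6 * of_int m + 1"
      by (rule strip)
    have J': "J \<subseteq> {..<11}" "insert i (insert j J) \<subseteq> {..<11}" using J(1) I(2) ij by auto
    have "triangle_wave (q $ 2 + sum y J) = q $ 2 + sum y J - 6 * of_int m"
      using J by (intro triangle_wave_up) auto
    moreover have "triangle_wave (q $ 2 + sum y (insert i (insert j J))) = q $ 2 + sum y (insert i (insert j J)) - 6 * of_int m"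
      using J xy(2,3)[OF ij(1)] xy(2,3)[OF ij(2)] by (intro triangle_wave_up) (auto simp: pair)
    ultimately have "x i + x j + y i + y j < sqrt 2"
      using osc[OF J'(2,1)] unfolding zz by (simp add: pair[OF J(1)])
    then show False
      using unit_vector_coordinate_sum[OF xy(1,2)[OF ij(1)]] unit_vector_coordinate_sum[OF xy(1,2)[OF ij(2)]]
        x sqrt2 by (simp add: ij)
  next
    assume x: "x i \<le> 0 \<and> x j \<le> 0"
    \<comment> \<open>Mirrored: the strip with \<open>A = 3\<close> opens a falling half, so
      climbing and moving left both lower \<open>zigzag\<close>, together by at least 2.\<close>
    obtain J m where J: "J \<subseteq> I" "3 + 6 * of_int m \<le> q $ 2 + sum y J"
      "q $ 2 + sum y J \<le> 3 + 6 * of_int m + 1"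
      by (rule strip)
    have J': "J \<subseteq> {..<11}" "insert i (insert j J) \<subseteq> {..<11}" using J(1) I(2) ij by auto
    have "triangle_wave (q $ 2 + sum y J) = 6 * of_int m + 6 - (q $ 2 + sum y J)"
      using J by (intro triangle_wave_down) auto
    moreover have "triangle_wave (q $ 2 + sum y (insert i (insert j J))) = 6 * of_int m + 6 - (q $ 2 + sum y (insert i (insert j J)))"
      using J xy(2,3)[OF ij(1)] xy(2,3)[OF ij(2)] by (intro triangle_wave_down) (auto simp: pair)
    ultimately have "- x i - x j + y i + y j < sqrt 2"
      using osc[OF J'(1,2)] unfolding zz by (simp add: pair[OF J(1)])
    then show False
      using unit_vector_coordinate_sum[of "- x i" "y i"] unit_vector_coordinate_sum[of "- x j" "y j"]
        xy[OF ij(1)] xy[OF ij(2)] x sqrt2 by simp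
  qed
qed

text \<open>Reversing the downward vectors only renames the corners: with the corner of
  \<open>N\<close> as the new origin, \<open>S\<close> names the corner of the symmetric difference
  of \<open>N\<close> and \<open>S\<close>.\<close>

lemma zigzag_cube:
  fixes v :: "nat \<Rightarrow> real^2"
  assumes unit: "\<And>k. k < 11 \<Longrightarrow> norm (v k) = 1"
    and const: "\<And>S. S \<subseteq> {..<11} \<Longrightarrow> \<lfloor>zigzag (q + sum v S) / sqrt 2\<rfloor> = n"
  shows False
proof -
  define N where "N = {k. k < 11 \<and> v k $ 2 < 0}"
  define v' where "v' k = (if k \<in> N then - v k else v k)" for k
  have N: "N \<subseteq> {..<11}" "finite N" by (auto simp: N_def)
  show False
  proof (rule zigzag_cube_upward[of v' "q + sum v N" n])
    show "norm (v' k) = 1" "0 \<le> v' k $ 2" if "k < 11" for k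
      using unit[OF that] that by (auto simp: v'_def N_def)
    show "\<lfloor>zigzag (q + sum v N + sum v' S) / sqrt 2\<rfloor> = n" if S: "S \<subseteq> {..<11}" for S
    proof -
      have fin: "finite S" using S finite_subset by blast
      have "sum v' S = sum v' (S \<inter> N) + sum v' (S - N)"
        using sum.Int_Diff[OF fin] .
      also have "sum v' (S \<inter> N) = - sum v (N \<inter> S)"
        unfolding sum_negf[symmetric] by (intro sum.cong) (auto simp: v'_def)
      also have "sum v' (S - N) = sum v (S - N)"
        by (intro sum.cong) (auto simp: v'_def)
      finally have "sum v N + sum v' S = sum v (N - S) + sum v (S - N)"
        using sum.Int_Diff[OF N(2), of v S] by simp
      also have "\<dots> = sum v ((N - S) \<union> (S - N))"
        using fin N(2) by (intro sum.union_disjoint[symmetric]) auto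
      finally have "q + sum v N + sum v' S = q + sum v ((N - S) \<union> (S - N))"
        by (simp add: add.assoc)
      moreover have "(N - S) \<union> (S - N) \<subseteq> {..<11}" using S N(1) by blast
      ultimately show ?thesis using const by metis
    qed
  qed
qed

text \<open>Inserting elements one at a time walks along unit edges, so equal colors force one floor
  at all corners. By \<open>unit_cube_affine\<close> the corners are subset sums of 11 unit vectors,
  which \<open>zigzag_cube\<close> rules out.\<close>

lemma no_monochromatic_hypercube:
  "\<not> (\<exists>A. unit_copy (hypercube 11) A \<and> monochromatic zigzag_coloring A)"
proof
  assume "\<exists>A. unit_copy (hypercube 11) A \<and> monochromatic zigzag_coloring A"
  then obtain A f c where bij: "bij_betw f (pverts (hypercube 11)) A"
    and edge: "\<And>u v. u \<in> pverts (hypercube 11) \<Longrightarrow> v \<in> pverts (hypercube 11) \<Longrightarrow>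
      (u, v) \<in> parcs (hypercube 11) \<Longrightarrow> norm (f u - f v) = 1"
    and mono: "\<And>z. z \<in> A \<Longrightarrow> zigzag_coloring z = c"
    unfolding unit_copy_def monochromatic_def by blast
  define g where "g S = f (vertex_of_set 11 S)" for S
  have color: "zigzag_coloring (g S) = c" for S
    using mono bij vertex_of_set_in_hypercube unfolding g_def by (metis bij_betwE)
  have inj: "inj_on g (Pow {..<11})"
  proof (rule inj_onI)
    fix S T :: "nat set" assume ST: "S \<in> Pow {..<11}" "T \<in> Pow {..<11}" and "g S = g T"
    then have "vertex_of_set 11 S = vertex_of_set 11 T"
      using bij vertex_of_set_in_hypercube unfolding g_def bij_betw_def by (metis inj_onD)
    then have "S \<inter> {..<11} = T \<inter> {..<11}" by (metis support_vertex_of_set)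
    then show "S = T" using ST by auto
  qed
  have unit: "norm (g (insert i S) - g S) = 1" if "insert i S \<subseteq> {..<11}" "i \<notin> S" for i S
  proof -
    have "(support (vertex_of_set 11 (insert i S)) - support (vertex_of_set 11 S)) \<union>
        (support (vertex_of_set 11 S) - support (vertex_of_set 11 (insert i S))) = {i}"
      using that by (auto simp: support_vertex_of_set)
    then have "(vertex_of_set 11 (insert i S), vertex_of_set 11 S) \<in> parcs (hypercube 11)"
      by (simp add: hypercube_arc_iff vertex_of_set_in_hypercube)
    then show ?thesis unfolding g_def using edge vertex_of_set_in_hypercube by blast
  qed
  have floor: "\<lfloor>zigzag (g S) / sqrt 2\<rfloor> = \<lfloor>zigzag (g {}) / sqrt 2\<rfloor>" if "finite S" "S \<subseteq> {..<11}" for S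
    using that
  proof (induction S)
    case (insert i S)
    then show ?case
      using zigzag_coloring_eq_imp_floor_eq[OF unit[of i S]] color by simp
  qed simp
  show False
  proof (rule zigzag_cube)
    show "norm (g {k} - g {}) = 1" if "k < 11" for k using unit[of k "{}"] that by simp
    show "\<lfloor>zigzag (g {} + (\<Sum>k\<in>S. g {k} - g {})) / sqrt 2\<rfloor> = \<lfloor>zigzag (g {}) / sqrt 2\<rfloor>"
      if "S \<subseteq> {..<11}" for S
    proof -
      have fin: "finite S" using that finite_subset by blast
      have "g S = g {} + (\<Sum>k\<in>S. g {k} - g {})"
        by (rule unit_cube_affine[OF inj unit that fin])
      then show ?thesis using floor[OF fin that] by simp
    qed
  qed
qed

lemma chi_plane_hypercube_11: "chi_plane (hypercube 11) = 2"
proof (rule antisym)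
  have "plane_coloring 2 zigzag_coloring"
    by (simp add: plane_coloring_def zigzag_coloring_def nat_less_iff)
  then show "chi_plane (hypercube 11) \<le> 2"
    unfolding chi_plane_def numeral_eq_enat
    using no_monochromatic_hypercube by (intro Inf_lower) blast
qed (rule chi_plane_hypercube_ge)

theorem theorem1p6:
  shows "(\<forall>H :: 'a pair_pre_digraph. pair_graph H \<longrightarrow>
            (layered H \<longrightarrow> chi_plane H > 2) \<and>
            (induced_layered H \<longrightarrow> chi_ind_plane H > 2)) \<and>
         (pair_graph (hypercube 11) \<and> bipartite (hypercube 11) \<and> chi_plane (hypercube 11) = 2)"
  by (simp add: layered_chi_plane induced_layered_chi_ind_plane pair_graph_hypercube
      bipartite_hypercube chi_plane_hypercube_11)

end
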